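(* There is a one-to-one correspondence between strict $3$-Lie $2$-algebras and crossed modules of $3$-Lie algebras.
   Context: Vector spaces are over a fixed base field. A $3$-Lie algebra is a vector space $\mathfrak g$ with a trilinear fully skew-symmetric map $[\cdot,\cdot,\cdot]:\wedge^3\mathfrak g\to\mathfrak g$ such that $[x_1,x_2,[x_3,x_4,x_5]]=[[x_1,x_2,x_3],x_4,x_5]+[x_3,[x_1,x_2,x_4],x_5]+[x_3,x_4,[x_1,x_2,x_5]]$ for all $x_i\in\mathfrak g$. $\mathrm{Der}(\mathfrak g)$ is the space of linear maps $D:\mathfrak g\to\mathfrak g$ with $D[x,y,z]=[Dx,y,z]+[x,Dy,z]+[x,y,Dz]$. On $\wedge^2\mathfrak g$ put $[x_1\wedge x_2,y_1\wedge y_2]_{\mathrm F}=[x_1,x_2,y_1]\wedge y_2+y_1\wedge[x_1,x_2,y_2]$. A representation of $\mathfrak g$ on a vector space $V$ is a linear map $\rho:\wedge^2\mathfrak g\to\mathfrak{gl}(V)$ with $[\rho(\mathfrak X),\rho(\mathfrak Y)]=\rho([\mathfrak X,\mathfrak Y]_{\mathrm F})$ for all $\mathfrak X,\mathfrak Y\in\wedge^2\mathfrak g$ and $\rho(x,[y_1,y_2,y_3])=\rho(y_2,y_3)\rho(x,y_1)-\rho(y_1,y_3)\rho(x,y_2)+\rho(y_1,y_2)\rho(x,y_3)$ for all $x,y_i\in\mathfrak g$. A crossed module of $3$-Lie algebras is a quadruple $((\mathfrak g,[\cdot,\cdot,\cdot]_{\mathfrak g}),(\mathfrak h,[\cdot,\cdot,\cdot]_{\mathfrak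 h}),\mu,\alpha)$ where $\mathfrak g,\mathfrak h$ are $3$-Lie algebras, $\mu:\mathfrak g\to\mathfrak h$ is a homomorphism of $3$-Lie algebras, and $\alpha:\wedge^2\mathfrak h\to\mathrm{Der}(\mathfrak g)$ is a representation of $\mathfrak h$ on $\mathfrak g$ (with values in derivations), such that for all $x,y\in\mathfrak h$, $f,g,h\in\mathfrak g$: $\mu(\alpha(x,y)(f))=[x,y,\mu(f)]_{\mathfrak h}$; $\alpha(\mu(f),\mu(g))(h)=[f,g,h]_{\mathfrak g}$; $\alpha(x,\mu(f))(g)=-\alpha(x,\mu(g))(f)$. A $3$-Lie $2$-algebra here means a $2$-term $3$-$Lie_\infty$-algebra $(V_1,V_0,\mathrm d,l_3,l_5)$; it is called strict if $l_5=0$. Written out, a strict $3$-Lie $2$-algebra is a complex of vector spaces $V_1\xrightarrow{\mathrm d}V_0$ with completely skew-symmetric trilinear maps $l_3:V_i\times V_j\times V_k\to V_{i+j+k}$, $0\le i+j+k\le1$, such that for all $x,y,x_i\in V_0$, $f,g,h\in V_1$: (a) $\mathrm d l_3(x,y,f)=l_3(x,y,\mathrm df)$; (b) $l_3(f,g,h)=0$ and $l_3(f,g,x)=0$; (c) $l_3(\mathrm df,g,x)=l_3(f,\mathrm dg,x)$; (d) $l_3(x_1,x_2,l_3(x_3,x_4,x_5))=l_3(l_3(x_1,x_2,x_3),x_4,x_5)+l_3(x_3,l_3(x_1,x_2,x_4),x_5)+l_3(x_3,x_4,l_3(x_1,x_2,x_5))$; (e) $l_3(f,x_2,l_3(x_3,x_4,x_5))=l_3(l_3(f,x_2,x_3),x_4,x_5)+l_3(x_3,l_3(f,x_2,x_4),x_5)+l_3(x_3,x_4,l_3(f,x_2,x_5))$;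 (f) $l_3(x_1,x_2,l_3(f,x_4,x_5))=l_3(l_3(x_1,x_2,f),x_4,x_5)+l_3(f,l_3(x_1,x_2,x_4),x_5)+l_3(f,x_4,l_3(x_1,x_2,x_5))$. *)

theory Defs
  imports
    "HOL-Library.Poly_Mapping"
    "HOL-Library.FuncSet"
    "HOL-Library.Set_Algebras"
    "HOL-Analysis.Product_Vector"
begin

text \<open>
  A vector space over the field \<open>'k\<close> is a type with a scalar multiplication \<open>s\<close> satisfying
  the library locale \<^locale>\<open>vector_space\<close>.
\<close>

section \<open>The exterior square\<close>

text \<open>
  \<open>\<Lambda>\<^sup>2 V\<close> is the free vector space on \<open>V \<times> V\<close> modulo the subspace generated by the relations
  which make \<open>(x, y) \<mapsto> x \<and> y\<close> bilinear and alternating.  Its elements are cosets.  As a type cannot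
  depend on \<open>s\<close>, it is a carrier set, and maps defined on it are required to be extensional.
\<close>

definition free_scale :: "'k::field \<Rightarrow> ('a \<Rightarrow>\<^sub>0 'k) \<Rightarrow> ('a \<Rightarrow>\<^sub>0 'k)" where
  "free_scale c u = Poly_Mapping.map ((*) c) u"

definition free_gen :: "'v \<Rightarrow> 'v \<Rightarrow> ('v \<times> 'v \<Rightarrow>\<^sub>0 'k::field)" where
  "free_gen x y = Poly_Mapping.single (x, y) 1"

inductive_set wedge_gens ::
    "('k::field \<Rightarrow> 'v::ab_group_add \<Rightarrow> 'v) \<Rightarrow> ('v \<times> 'v \<Rightarrow>\<^sub>0 'k) set"
  for s where
  add_left: "free_gen (x + x') y - free_gen x y - free_gen x' y \<in> wedge_gens s"
| add_right: "free_gen x (y + y') - free_gen x y - free_gen x y' \<in> wedge_gens s"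
| scale_left: "free_gen (s c x) y - free_scale c (free_gen x y) \<in> wedge_gens s"
| scale_right: "free_gen x (s c y) - free_scale c (free_gen x y) \<in> wedge_gens s"
| alternating: "free_gen x x \<in> wedge_gens s"

definition wedge_rel ::
    "('k::field \<Rightarrow> 'v::ab_group_add \<Rightarrow> 'v) \<Rightarrow> ('v \<times> 'v \<Rightarrow>\<^sub>0 'k) set" where
  "wedge_rel s = module.span free_scale (wedge_gens s)"

definition wedge_class ::
    "('k::field \<Rightarrow> 'v::ab_group_add \<Rightarrow> 'v) \<Rightarrow> ('v \<times> 'v \<Rightarrow>\<^sub>0 'k) \<Rightarrow> ('v \<times> 'v \<Rightarrow>\<^sub>0 'k) set" where
  "wedge_class s u = u +o wedge_rel s"

definition ext_square ::
    "('k::field \<Rightarrow> 'v::ab_group_add \<Rightarrow> 'v) \<Rightarrow> ('v \<times> 'v \<Rightarrow>\<^sub>0 'k) set set" where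
  "ext_square s = wedge_class s ` UNIV"

text \<open>
  The sum of two cosets is their elementwise sum (\<^theory>\<open>HOL-Library.Set_Algebras\<close>).  In the next
  definition, the summand \<open>wedge_rel s\<close> only matters when \<open>c = 0\<close>.
\<close>

definition ext_scale ::
    "('k::field \<Rightarrow> 'v::ab_group_add \<Rightarrow> 'v) \<Rightarrow> 'k \<Rightarrow> ('v \<times> 'v \<Rightarrow>\<^sub>0 'k) set \<Rightarrow> ('v \<times> 'v \<Rightarrow>\<^sub>0 'k) set" where
  "ext_scale s c X = free_scale c ` X + wedge_rel s"

definition wedge ::
    "('k::field \<Rightarrow> 'v::ab_group_add \<Rightarrow> 'v) \<Rightarrow> 'v \<Rightarrow> 'v \<Rightarrow> ('v \<times> 'v \<Rightarrow>\<^sub>0 'k) set" where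
  "wedge s x y = wedge_class s (free_gen x y)"


section \<open>3-Lie algebras\<close>

definition trilinear ::
    "('k::field \<Rightarrow> 'v::ab_group_add \<Rightarrow> 'v) \<Rightarrow> ('v \<Rightarrow> 'v \<Rightarrow> 'v \<Rightarrow> 'v) \<Rightarrow> bool" where
  "trilinear s t \<longleftrightarrow>
     (\<forall>y z. Vector_Spaces.linear s s (\<lambda>x. t x y z)) \<and>
     (\<forall>x z. Vector_Spaces.linear s s (\<lambda>y. t x y z)) \<and>
     (\<forall>x y. Vector_Spaces.linear s s (\<lambda>z. t x y z))"

text \<open>
  Full skew-symmetry means that the map factors through the exterior power, i.e. it vanishes
  when two arguments coincide.  In characteristic other than 2, this is the sign rule for
  transpositions.
\<close>

definition fully_skew :: "('v \<Rightarrow> 'v \<Rightarrow> 'v \<Rightarrow> 'v::zero) \<Rightarrow> bool" where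
  "fully_skew t \<longleftrightarrow> (\<forall>x y. t x x y = 0 \<and> t x y x = 0 \<and> t y x x = 0)"

definition three_lie_algebra ::
    "('k::field \<Rightarrow> 'v::ab_group_add \<Rightarrow> 'v) \<Rightarrow> ('v \<Rightarrow> 'v \<Rightarrow> 'v \<Rightarrow> 'v) \<Rightarrow> bool" where
  "three_lie_algebra s br \<longleftrightarrow>
     vector_space s \<and> trilinear s br \<and> fully_skew br \<and>
     (\<forall>x1 x2 x3 x4 x5.
        br x1 x2 (br x3 x4 x5)
        = br (br x1 x2 x3) x4 x5 + br x3 (br x1 x2 x4) x5 + br x3 x4 (br x1 x2 x5))"

definition three_lie_hom ::
    "('k::field \<Rightarrow> 'g::ab_group_add \<Rightarrow> 'g) \<Rightarrow> ('g \<Rightarrow> 'g \<Rightarrow> 'g \<Rightarrow> 'g) \<Rightarrow>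
     ('k \<Rightarrow> 'h::ab_group_add \<Rightarrow> 'h) \<Rightarrow> ('h \<Rightarrow> 'h \<Rightarrow> 'h \<Rightarrow> 'h) \<Rightarrow> ('g \<Rightarrow> 'h) \<Rightarrow> bool" where
  "three_lie_hom sg brg sh brh \<mu> \<longleftrightarrow>
     Vector_Spaces.linear sg sh \<mu> \<and>
     (\<forall>x y z. \<mu> (brg x y z) = brh (\<mu> x) (\<mu> y) (\<mu> z))"

definition Der ::
    "('k::field \<Rightarrow> 'v::ab_group_add \<Rightarrow> 'v) \<Rightarrow> ('v \<Rightarrow> 'v \<Rightarrow> 'v \<Rightarrow> 'v) \<Rightarrow> ('v \<Rightarrow> 'v) set" where
  "Der s br =
     {D. Vector_Spaces.linear s s D \<and>
         (\<forall>x y z. D (br x y z) = br (D x) y z + br x (D y) z + br x y (D z))}"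

text \<open>
  The bracket on \<open>\<Lambda>\<^sup>2 V\<close> is the bilinear extension of
  \<open>[x\<^sub>1 \<and> x\<^sub>2, y\<^sub>1 \<and> y\<^sub>2]\<^sub>F = [x\<^sub>1, x\<^sub>2, y\<^sub>1] \<and> y\<^sub>2 + y\<^sub>1 \<and> [x\<^sub>1, x\<^sub>2, y\<^sub>2]\<close>, computed on representatives.
  For a trilinear, fully skew-symmetric bracket the result does not depend on the chosen
  representatives.
\<close>

definition free_bracket ::
    "('v \<Rightarrow> 'v \<Rightarrow> 'v \<Rightarrow> 'v) \<Rightarrow> ('v \<times> 'v \<Rightarrow>\<^sub>0 'k::field) \<Rightarrow> ('v \<times> 'v \<Rightarrow>\<^sub>0 'k) \<Rightarrow> ('v \<times> 'v \<Rightarrow>\<^sub>0 'k)" where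
  "free_bracket br u v =
     (\<Sum>(x1, x2)\<in>Poly_Mapping.keys u. \<Sum>(y1, y2)\<in>Poly_Mapping.keys v.
        free_scale (Poly_Mapping.lookup u (x1, x2) * Poly_Mapping.lookup v (y1, y2))
          (free_gen (br x1 x2 y1) y2 + free_gen y1 (br x1 x2 y2)))"

definition F_bracket ::
    "('k::field \<Rightarrow> 'v::ab_group_add \<Rightarrow> 'v) \<Rightarrow> ('v \<Rightarrow> 'v \<Rightarrow> 'v \<Rightarrow> 'v) \<Rightarrow>
     ('v \<times> 'v \<Rightarrow>\<^sub>0 'k) set \<Rightarrow> ('v \<times> 'v \<Rightarrow>\<^sub>0 'k) set \<Rightarrow> ('v \<times> 'v \<Rightarrow>\<^sub>0 'k) set" where
  "F_bracket s br X Y = wedge_class s (free_bracket br (SOME u. u \<in> X) (SOME v. v \<in> Y))"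

definition three_lie_rep ::
    "('k::field \<Rightarrow> 'g::ab_group_add \<Rightarrow> 'g) \<Rightarrow> ('g \<Rightarrow> 'g \<Rightarrow> 'g \<Rightarrow> 'g) \<Rightarrow>
     ('k \<Rightarrow> 'v::ab_group_add \<Rightarrow> 'v) \<Rightarrow> (('g \<times> 'g \<Rightarrow>\<^sub>0 'k) set \<Rightarrow> 'v \<Rightarrow> 'v) \<Rightarrow> bool" where
  "three_lie_rep s br sv \<rho> \<longleftrightarrow>
     vector_space sv \<and>
     \<rho> \<in> ext_square s \<rightarrow>\<^sub>E {T. Vector_Spaces.linear sv sv T} \<and>
     (\<forall>X\<in>ext_square s. \<forall>Y\<in>ext_square s. \<rho> (X + Y) = (\<lambda>v. \<rho> X v + \<rho> Y v)) \<and>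
     (\<forall>c. \<forall>X\<in>ext_square s. \<rho> (ext_scale s c X) = (\<lambda>v. sv c (\<rho> X v))) \<and>
     (\<forall>X\<in>ext_square s. \<forall>Y\<in>ext_square s.
        (\<lambda>v. \<rho> X (\<rho> Y v) - \<rho> Y (\<rho> X v)) = \<rho> (F_bracket s br X Y)) \<and>
     (\<forall>x y1 y2 y3.
        \<rho> (wedge s x (br y1 y2 y3))
        = (\<lambda>v. \<rho> (wedge s y2 y3) (\<rho> (wedge s x y1) v)
             - \<rho> (wedge s y1 y3) (\<rho> (wedge s x y2) v)
             + \<rho> (wedge s y1 y2) (\<rho> (wedge s x y3) v)))"


section \<open>Crossed modules of 3-Lie algebras\<close>

definition crossed_module ::
    "('k::field \<Rightarrow> 'g::ab_group_add \<Rightarrow> 'g) \<Rightarrow> ('k \<Rightarrow> 'h::ab_group_add \<Rightarrow> 'h) \<Rightarrow>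
     ('g \<Rightarrow> 'g \<Rightarrow> 'g \<Rightarrow> 'g) \<Rightarrow> ('h \<Rightarrow> 'h \<Rightarrow> 'h \<Rightarrow> 'h) \<Rightarrow>
     ('g \<Rightarrow> 'h) \<Rightarrow> (('h \<times> 'h \<Rightarrow>\<^sub>0 'k) set \<Rightarrow> 'g \<Rightarrow> 'g) \<Rightarrow> bool" where
  "crossed_module sg sh brg brh \<mu> \<alpha> \<longleftrightarrow>
     three_lie_algebra sg brg \<and> three_lie_algebra sh brh \<and>
     three_lie_hom sg brg sh brh \<mu> \<and>
     three_lie_rep sh brh sg \<alpha> \<and> (\<forall>X\<in>ext_square sh. \<alpha> X \<in> Der sg brg) \<and>
     (\<forall>x y f. \<mu> (\<alpha> (wedge sh x y) f) = brh x y (\<mu> f)) \<and>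
     (\<forall>f g h. \<alpha> (wedge sh (\<mu> f) (\<mu> g)) h = brg f g h) \<and>
     (\<forall>x f g. \<alpha> (wedge sh x (\<mu> f)) g = - \<alpha> (wedge sh x (\<mu> g)) f)"


section \<open>Strict 3-Lie 2-algebras\<close>

text \<open>
  The maps \<open>l\<^sub>3 : V\<^sub>i \<times> V\<^sub>j \<times> V\<^sub>k \<rightarrow> V\<^sub>i\<^sub>+\<^sub>j\<^sub>+\<^sub>k\<close> are collected in one map on the total space
  \<open>V\<^sub>0 \<oplus> V\<^sub>1\<close>.
\<close>

definition in0 :: "'v0 \<Rightarrow> 'v0 \<times> 'v1::zero" where
  "in0 x = (x, 0)"

definition in1 :: "'v1 \<Rightarrow> 'v0::zero \<times> 'v1" where
  "in1 f = (0, f)"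

definition strict_three_lie_two_algebra ::
    "('k::field \<Rightarrow> 'v1::ab_group_add \<Rightarrow> 'v1) \<Rightarrow> ('k \<Rightarrow> 'v0::ab_group_add \<Rightarrow> 'v0) \<Rightarrow>
     ('v1 \<Rightarrow> 'v0) \<Rightarrow> ('v0 \<times> 'v1 \<Rightarrow> 'v0 \<times> 'v1 \<Rightarrow> 'v0 \<times> 'v1 \<Rightarrow> 'v0 \<times> 'v1) \<Rightarrow> bool" where
  "strict_three_lie_two_algebra s1 s0 d l \<longleftrightarrow>
     Vector_Spaces.linear s1 s0 d \<and>
     trilinear (module_prod.scale s0 s1) l \<and> fully_skew l \<and>
     \<comment> \<open>the other argument orders follow by skew-symmetry\<close>
     (\<forall>x y z. l (in0 x) (in0 y) (in0 z) \<in> in0 ` UNIV) \<and>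
     (\<forall>x y f. l (in0 x) (in0 y) (in1 f) \<in> in1 ` UNIV) \<and>
     (\<forall>x y f. in0 (d (snd (l (in0 x) (in0 y) (in1 f)))) = l (in0 x) (in0 y) (in0 (d f))) \<and>
     (\<forall>f g h. l (in1 f) (in1 g) (in1 h) = 0) \<and>
     (\<forall>f g x. l (in1 f) (in1 g) (in0 x) = 0) \<and>
     (\<forall>f g x. l (in0 (d f)) (in1 g) (in0 x) = l (in1 f) (in0 (d g)) (in0 x)) \<and>
     (\<forall>x1 x2 x3 x4 x5.
        l (in0 x1) (in0 x2) (l (in0 x3) (in0 x4) (in0 x5))
        = l (l (in0 x1) (in0 x2) (in0 x3)) (in0 x4) (in0 x5)
        + l (in0 x3) (l (in0 x1) (in0 x2) (in0 x4)) (in0 x5)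
        + l (in0 x3) (in0 x4) (l (in0 x1) (in0 x2) (in0 x5))) \<and>
     (\<forall>f x2 x3 x4 x5.
        l (in1 f) (in0 x2) (l (in0 x3) (in0 x4) (in0 x5))
        = l (l (in1 f) (in0 x2) (in0 x3)) (in0 x4) (in0 x5)
        + l (in0 x3) (l (in1 f) (in0 x2) (in0 x4)) (in0 x5)
        + l (in0 x3) (in0 x4) (l (in1 f) (in0 x2) (in0 x5))) \<and>
     (\<forall>x1 x2 f x4 x5.
        l (in0 x1) (in0 x2) (l (in1 f) (in0 x4) (in0 x5))
        = l (l (in0 x1) (in0 x2) (in1 f)) (in0 x4) (in0 x5)
        + l (in1 f) (l (in0 x1) (in0 x2) (in0 x4)) (in0 x5)
        + l (in1 f) (in0 x4) (l (in0 x1) (in0 x2) (in0 x5)))"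

end

theory Submission
  imports Defs
begin

text \<open>
  Both structures amount to a 3-Lie algebra \<open>V\<^sub>0\<close> together with \<open>d : V\<^sub>1 \<rightarrow> V\<^sub>0\<close> and a compatible
  action of \<open>\<Lambda>\<^sup>2 V\<^sub>0\<close> on \<open>V\<^sub>1\<close>.  On the strict side, \<open>l\<^sub>3\<close> vanishes on two arguments from \<open>V\<^sub>1\<close>, so
  it is determined by \<open>l\<^sub>3(x, y, z)\<close> and \<open>l\<^sub>3(x, y, f)\<close>.  On the crossed module side, \<open>\<alpha>\<close> is
  determined by its values on \<open>x \<and> y\<close>, and the bracket of \<open>V\<^sub>1\<close> is \<open>\<alpha>(\<mu> f \<and> \<mu> g) h\<close>.
  Conditions (e) and (f) then become the two representation axioms, and (c) becomes
  \<open>\<alpha>(x \<and> \<mu> f) g = - \<alpha>(x \<and> \<mu> g) f\<close>.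
\<close>

section \<open>Free vector spaces\<close>

lemma lookup_free_scale [simp]:
  "Poly_Mapping.lookup (free_scale c u) p = c * Poly_Mapping.lookup u p"
  by (simp add: free_scale_def Poly_Mapping.map.rep_eq when_def)

interpretation free: vector_space free_scale
  by unfold_locales (auto intro!: poly_mapping_eqI simp: lookup_add algebra_simps)

text \<open>The linear extension of \<open>B\<close> from the basis of the free space. Maps on the
  exterior square are computed with it on a representative of a coset and then shown to respect the
  relations.\<close>

definition free_lift ::
    "('k::field \<Rightarrow> 'w::ab_group_add \<Rightarrow> 'w) \<Rightarrow> ('a \<Rightarrow> 'w) \<Rightarrow> ('a \<Rightarrow>\<^sub>0 'k) \<Rightarrow> 'w" where
  "free_lift s B u = (\<Sum>p\<in>Poly_Mapping.keys u. s (Poly_Mapping.lookup u p) (B p))"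

context vector_space
begin

text \<open>Keys outside the support contribute zero. This allows one index set for
  \<open>u\<close>, \<open>v\<close> and \<open>u + v\<close>, whose support may shrink through
  cancellation.\<close>

lemma free_lift_superset:
  assumes "finite P" and "Poly_Mapping.keys u \<subseteq> P"
  shows "free_lift scale B u = (\<Sum>p\<in>P. scale (Poly_Mapping.lookup u p) (B p))"
  unfolding free_lift_def
  by (rule sum.mono_neutral_left) (use assms in \<open>auto simp: in_keys_iff\<close>)

lemma linear_free_lift: "Vector_Spaces.linear free_scale scale (free_lift scale B)"
  unfolding Vector_Spaces.linear_iff
proof (intro conjI allI)
  fix u v :: "'c \<Rightarrow>\<^sub>0 'a" and c :: 'a
  let ?P = "Poly_Mapping.keys u \<union> Poly_Mapping.keys v"
  have "free_lift scale B (u + v) = (\<Sum>p\<in>?P. scale (Poly_Mapping.lookup (u + v) p) (B p))"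
    by (rule free_lift_superset) (simp_all add: Poly_Mapping.keys_add)
  also have "\<dots> = free_lift scale B u + free_lift scale B v"
    by (simp add: free_lift_superset[of ?P] lookup_add scale_left_distrib sum.distrib)
  finally show "free_lift scale B (u + v) = free_lift scale B u + free_lift scale B v" .
  have "free_lift scale B (free_scale c u)
      = (\<Sum>p\<in>Poly_Mapping.keys u. scale (Poly_Mapping.lookup (free_scale c u) p) (B p))"
    by (rule free_lift_superset) (auto simp: in_keys_iff)
  also have "\<dots> = scale c (free_lift scale B u)"
    by (simp add: free_lift_def scale_sum_right)
  finally show "free_lift scale B (free_scale c u) = scale c (free_lift scale B u)" .
qed (unfold_locales)

lemmas free_lift_hom = linear_free_lift[THEN module_hom_linearI]
lemmas free_lift_add = free_lift_hom[THEN module_hom.add]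
  and free_lift_diff = free_lift_hom[THEN module_hom.diff]
  and free_lift_scale = free_lift_hom[THEN module_hom.scale]

lemma free_lift_single: "free_lift scale B (Poly_Mapping.single p 1) = B p"
  by (simp add: free_lift_def)

lemma free_lift_fun_add:
  "free_lift scale (\<lambda>p. B p + C p) u = free_lift scale B u + free_lift scale C u"
  by (simp add: free_lift_def sum.distrib scale_right_distrib)

lemma free_lift_fun_diff:
  "free_lift scale (\<lambda>p. B p - C p) u = free_lift scale B u - free_lift scale C u"
  by (simp add: free_lift_def sum_subtractf scale_right_diff_distrib)

lemma free_lift_fun_scale:
  "free_lift scale (\<lambda>p. scale c (B p)) u = scale c (free_lift scale B u)"
  by (simp add: free_lift_def scale_sum_right mult.commute)

lemma linear_free_lift_fun:
  assumes "vector_space t" and "\<And>p. Vector_Spaces.linear t scale (\<lambda>v. B p v)"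
  shows "Vector_Spaces.linear t scale (\<lambda>v. free_lift scale (\<lambda>p. B p v) u)"
  using assms(2)
  by (auto simp: Vector_Spaces.linear_iff assms(1) vector_space_axioms free_lift_fun_add
      free_lift_fun_scale)

text \<open>Exchange of two finite sums. It is what lets an iterated expansion over \<open>u\<close>
  and \<open>v\<close> be read in either order.\<close>

lemma free_lift_commute:
  "free_lift scale (\<lambda>p. free_lift scale (B p) v) u
   = free_lift scale (\<lambda>q. free_lift scale (\<lambda>p. B p q) u) v"
  unfolding free_lift_def scale_sum_right
  by (subst sum.swap) (simp add: mult.commute)

end

lemma linear_free_lift_commute:
  assumes "Vector_Spaces.linear s t T"
  shows "T (free_lift s B u) = free_lift t (\<lambda>p. T (B p)) u"
proof -
  interpret T: module_hom s t T
    using assms by (rule module_hom_linearI)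
  show ?thesis
    by (simp add: free_lift_def T.sum T.scale)
qed

text \<open>Together with \<open>linear_free_lift_commute\<close> this gives uniqueness: a linear
  map on the free space is determined by its values on the basis.\<close>

lemma free_poly_eq_free_lift: "u = free_lift free_scale (\<lambda>p. Poly_Mapping.single p 1) u"
proof (rule poly_mapping_eqI)
  fix q
  have *: "Poly_Mapping.lookup (\<Sum>p\<in>P. f p) q = (\<Sum>p\<in>P. Poly_Mapping.lookup (f p) q)"
    for P :: "'a set" and f :: "'a \<Rightarrow> ('a \<Rightarrow>\<^sub>0 'b)"
    by (induction P rule: infinite_finite_induct) (simp_all add: lookup_add)
  have "(\<Sum>p\<in>Poly_Mapping.keys u. Poly_Mapping.lookup u p * (1 when p = q))
      = (\<Sum>p\<in>Poly_Mapping.keys u. if p = q then Poly_Mapping.lookup u p else 0)"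
    by (rule sum.cong) (simp_all add: when_def)
  then show "Poly_Mapping.lookup u q
      = Poly_Mapping.lookup (free_lift free_scale (\<lambda>p. Poly_Mapping.single p 1) u) q"
    by (simp add: free_lift_def * lookup_single in_keys_iff)
qed

section \<open>The exterior square\<close>

lemma subspace_wedge_rel: "free.subspace (wedge_rel s)"
  by (simp add: wedge_rel_def)

lemma wedge_gens_in_wedge_rel: "u \<in> wedge_gens s \<Longrightarrow> u \<in> wedge_rel s"
  by (simp add: wedge_rel_def free.span_base)

lemmas wedge_rel_zero = free.subspace_0[OF subspace_wedge_rel]
  and wedge_rel_add = free.subspace_add[OF subspace_wedge_rel]
  and wedge_rel_diff = free.subspace_diff[OF subspace_wedge_rel]
  and wedge_rel_scale = free.subspace_scale[OF subspace_wedge_rel]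

section \<open>Cosets and their vector space operations\<close>

lemma mem_wedge_class: "v \<in> wedge_class s u \<longleftrightarrow> v - u \<in> wedge_rel s"
  by (auto simp: wedge_class_def elt_set_plus_def intro!: bexI[of _ "v - u"])

lemma wedge_class_self: "u \<in> wedge_class s u"
  by (simp add: mem_wedge_class wedge_rel_zero)

lemma wedge_class_eq_iff: "wedge_class s u = wedge_class s v \<longleftrightarrow> u - v \<in> wedge_rel s"
proof
  assume "wedge_class s u = wedge_class s v"
  then show "u - v \<in> wedge_rel s"
    using wedge_class_self[of u s] by (simp add: mem_wedge_class)
next
  assume uv: "u - v \<in> wedge_rel s"
  have "w - u \<in> wedge_rel s \<longleftrightarrow> w - v \<in> wedge_rel s" for w
    using wedge_rel_add[OF _ uv, of "w - u"] wedge_rel_diff[OF _ uv, of "w - v"] by auto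
  then show "wedge_class s u = wedge_class s v"
    by (auto simp: mem_wedge_class)
qed

lemma ext_squareE:
  assumes "X \<in> ext_square s"
  obtains u where "X = wedge_class s u"
  using assms by (auto simp: ext_square_def)

lemma wedge_class_in_ext_square [simp]: "wedge_class s u \<in> ext_square s"
  by (simp add: ext_square_def)

lemma wedge_in_ext_square [simp]: "wedge s x y \<in> ext_square s"
  by (simp add: wedge_def)

lemma wedge_class_add: "wedge_class s u + wedge_class s v = wedge_class s (u + v)"
proof (rule set_eqI)
  fix w
  have "w \<in> wedge_class s u + wedge_class s v"
    if "w - (u + v) \<in> wedge_rel s"
  proof -
    have "w = (w - v) + v" "w - v \<in> wedge_class s u" "v \<in> wedge_class s v"
      using that by (simp_all add: mem_wedge_class wedge_rel_zero diff_diff_eq add.commute)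
    then show ?thesis
      by (metis set_plus_intro)
  qed
  moreover have "w - (u + v) \<in> wedge_rel s" if w: "w \<in> wedge_class s u + wedge_class s v"
  proof -
    obtain a b where "w = a + b" "a - u \<in> wedge_rel s" "b - v \<in> wedge_rel s"
      using w by (auto simp: set_plus_def mem_wedge_class)
    then show ?thesis
      using wedge_rel_add[of "a - u" s "b - v"] by (simp add: algebra_simps)
  qed
  ultimately show "w \<in> wedge_class s u + wedge_class s v \<longleftrightarrow> w \<in> wedge_class s (u + v)"
    by (auto simp: mem_wedge_class)
qed

lemma ext_scale_wedge_class: "ext_scale s c (wedge_class s u) = wedge_class s (free_scale c u)"
proof (rule set_eqI)
  fix w
  have "w \<in> ext_scale s c (wedge_class s u)" if "w - free_scale c u \<in> wedge_rel s"
  proof -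
    have "w = free_scale c u + (w - free_scale c u)"
      by simp
    then show ?thesis
      unfolding ext_scale_def using that wedge_class_self[of u s] by (metis imageI set_plus_intro)
  qed
  moreover have "w - free_scale c u \<in> wedge_rel s" if w: "w \<in> ext_scale s c (wedge_class s u)"
  proof -
    obtain a b where "w = free_scale c a + b" "a - u \<in> wedge_rel s" "b \<in> wedge_rel s"
      using w by (auto simp: ext_scale_def set_plus_def mem_wedge_class)
    then show ?thesis
      using wedge_rel_add[OF wedge_rel_scale[of "a - u" s c], of b]
      by (simp add: free.scale_right_diff_distrib algebra_simps)
  qed
  ultimately show "w \<in> ext_scale s c (wedge_class s u) \<longleftrightarrow> w \<in> wedge_class s (free_scale c u)"
    by (auto simp: mem_wedge_class)
qed

lemma wedge_alternating: "wedge s x x = wedge_class s 0"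
  by (simp add: wedge_def wedge_class_eq_iff wedge_gens_in_wedge_rel wedge_gens.alternating)

lemma wedge_add_left: "wedge s (x + x') y = wedge s x y + wedge s x' y"
  by (simp add: wedge_def wedge_class_add wedge_class_eq_iff wedge_gens_in_wedge_rel
      wedge_gens.add_left diff_diff_eq[symmetric])

lemma wedge_add_right: "wedge s x (y + y') = wedge s x y + wedge s x y'"
  by (simp add: wedge_def wedge_class_add wedge_class_eq_iff wedge_gens_in_wedge_rel
      wedge_gens.add_right diff_diff_eq[symmetric])

lemma wedge_scale_left: "wedge s (s c x) y = ext_scale s c (wedge s x y)"
  by (simp add: wedge_def ext_scale_wedge_class wedge_class_eq_iff wedge_gens_in_wedge_rel
      wedge_gens.scale_left)

lemma wedge_scale_right: "wedge s x (s c y) = ext_scale s c (wedge s x y)"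
  by (simp add: wedge_def ext_scale_wedge_class wedge_class_eq_iff wedge_gens_in_wedge_rel
      wedge_gens.scale_right)

section \<open>Maps on the free space that respect the relations\<close>

lemma linear_into_subspace_vanishes_on_wedge_rel:
  assumes T: "Vector_Spaces.linear free_scale t T" and S: "module.subspace t S"
    and gens: "\<And>u. u \<in> wedge_gens s \<Longrightarrow> T u \<in> S" and u: "u \<in> wedge_rel s"
  shows "T u \<in> S"
proof -
  interpret T: module_hom free_scale t T
    using T by (rule module_hom_linearI)
  have "free.subspace {u. T u \<in> S}"
    using T.subspace_vimage[OF S] by (simp add: vimage_def)
  then show ?thesis
    using free.span_minimal[of "wedge_gens s" "{u. T u \<in> S}"] gens u
    by (auto simp: wedge_rel_def)
qed

text \<open>The universal property of the exterior square relative to a subspace: \<open>B\<close>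
  is bilinear and alternating modulo \<open>S\<close>. The choice \<open>S = {0}\<close> serves
  actions, and \<open>S = wedge_rel s\<close> serves the bracket.\<close>

lemma free_lift_wedge_rel:
  assumes t: "vector_space t" and S: "module.subspace t S"
    and "\<And>x x' y. B (x + x') y - B x y - B x' y \<in> S"
    and "\<And>x y y'. B x (y + y') - B x y - B x y' \<in> S"
    and "\<And>c x y. B (s c x) y - t c (B x y) \<in> S"
    and "\<And>c x y. B x (s c y) - t c (B x y) \<in> S"
    and "\<And>x. B x x \<in> S"
    and u: "u \<in> wedge_rel s"
  shows "free_lift t (\<lambda>(x, y). B x y) u \<in> S"
proof -
  interpret t: vector_space t by fact
  show ?thesis
  proof (rule linear_into_subspace_vanishes_on_wedge_rel[OF t.linear_free_lift S _ u])
    show "free_lift t (\<lambda>(x, y). B x y) v \<in> S" if "v \<in> wedge_gens s" for v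
      using that assms(3-7)
      by cases (simp_all add: t.free_lift_diff t.free_lift_scale t.free_lift_single free_gen_def)
  qed
qed

lemma free_lift_in_subspace:
  assumes "vector_space t" and "module.subspace t S" and "\<And>p. B p \<in> S"
  shows "free_lift t B u \<in> S"
proof -
  interpret t: vector_space t by fact
  show ?thesis
    unfolding free_lift_def using assms(2,3) by (intro t.subspace_sum t.subspace_scale)
qed

text \<open>Writing the zero vector as \<open>s 0 0\<close> makes this an instance of the
  homogeneity relation.\<close>

lemma free_gen_zero_left: "vector_space s \<Longrightarrow> free_gen 0 y \<in> wedge_rel s"
  using wedge_gens_in_wedge_rel[OF wedge_gens.scale_left[of s 0 0 y]]
  by (simp add: module.scale_zero_left module_iff_vector_space)

lemma free_gen_zero_right: "vector_space s \<Longrightarrow> free_gen x 0 \<in> wedge_rel s"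
  using wedge_gens_in_wedge_rel[OF wedge_gens.scale_right[of x s 0 0]]
  by (simp add: module.scale_zero_left module_iff_vector_space)

text \<open>Polarisation: expand the alternating generator at \<open>x + y\<close> by additivity;
  removing the two squares leaves the mixed terms.\<close>

lemma free_gen_skew: "free_gen x y + free_gen y x \<in> wedge_rel s"
proof -
  note rel = wedge_gens_in_wedge_rel[of _ s]
  have "free_gen (x + y) (x + y)
      - (free_gen (x + y) (x + y) - free_gen x (x + y) - free_gen y (x + y))
      - (free_gen x (x + y) - free_gen x x - free_gen x y)
      - (free_gen y (x + y) - free_gen y x - free_gen y y)
      - free_gen x x - free_gen y y \<in> wedge_rel s"
    by (intro wedge_rel_diff rel wedge_gens.intros)
  then show ?thesis
    by (simp add: algebra_simps)
qed

section \<open>The bracket on representatives and on cosets\<close>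

lemma free_bracket_eq_free_lift:
  "free_bracket br u v =
     free_lift free_scale (\<lambda>(x1, x2). free_lift free_scale
       (\<lambda>(y1, y2). free_gen (br x1 x2 y1) y2 + free_gen y1 (br x1 x2 y2)) v) u"
  by (simp add: free_bracket_def free_lift_def free.scale_sum_right case_prod_unfold)

text \<open>Expanding \<open>v\<close> outermost shows linearity in the second argument and leaves,
  for fixed \<open>y1\<close> and \<open>y2\<close>, a single lift over \<open>u\<close>. The other
  form does the same with the roles exchanged.\<close>

lemma free_bracket_eq_free_lift_swap:
  "free_bracket br u v =
     free_lift free_scale (\<lambda>(y1, y2). free_lift free_scale
       (\<lambda>(x1, x2). free_gen (br x1 x2 y1) y2 + free_gen y1 (br x1 x2 y2)) u) v"
  unfolding free_bracket_eq_free_lift case_prod_unfold by (rule free.free_lift_commute)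

lemma free_bracket_diff_left:
  "free_bracket br (u - u') v = free_bracket br u v - free_bracket br u' v"
  by (simp add: free_bracket_eq_free_lift free.free_lift_diff)

lemma free_bracket_diff_right:
  "free_bracket br u (v - v') = free_bracket br u v - free_bracket br u v'"
  by (simp add: free_bracket_eq_free_lift_swap free.free_lift_diff)

lemma free_bracket_free_gen:
  "free_bracket br (free_gen x1 x2) (free_gen y1 y2)
   = free_gen (br x1 x2 y1) y2 + free_gen y1 (br x1 x2 y2)"
  by (simp add: free_bracket_eq_free_lift free_gen_def free.free_lift_single)

text \<open>What the bracket of a 3-Lie algebra has in common with \<open>l\<close> on the total
  space. Both are instances below, so the sign rules are derived once.\<close>

locale skew_trilinear =
  fixes s :: "'k::field \<Rightarrow> 'v::ab_group_add \<Rightarrow> 'v" and br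
  assumes trilinear: "trilinear s br" and skew: "fully_skew br"
begin

lemma vector_space: "vector_space s"
  using trilinear by (auto simp: trilinear_def Vector_Spaces.linear_iff)

lemma br_simps:
  "br (x + x') y z = br x y z + br x' y z" "br x (y + y') z = br x y z + br x y' z"
  "br x y (z + z') = br x y z + br x y z'"
  "br (s c x) y z = s c (br x y z)" "br x (s c y) z = s c (br x y z)"
  "br x y (s c z) = s c (br x y z)"
  "br x x y = 0" "br x y x = 0" "br y x x = 0"
  using trilinear skew by (auto simp: trilinear_def fully_skew_def Vector_Spaces.linear_iff)

text \<open>Polarisation again: it turns vanishing on equal arguments into the sign rule, in any
  characteristic.\<close>

lemma br_swap12: "br y x z = - br x y z"
  using br_simps(7)[of "x + y" z, unfolded br_simps(1,2)]
  by (simp add: br_simps(7) eq_neg_iff_add_eq_0 add.commute)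

lemma br_swap23: "br x z y = - br x y z"
  using br_simps(9)[of x "y + z", unfolded br_simps(2,3)]
  by (simp add: br_simps(9) eq_neg_iff_add_eq_0 add.commute)

lemma br_rotate: "br y z x = br x y z"
  by (simp add: br_swap12[of x y z] br_swap23[of y x z])

lemma br_zero: "br 0 y z = 0" "br x 0 z = 0" "br x y 0 = 0"
  using br_simps(1)[of 0 0] br_simps(2)[of _ 0 0] br_simps(3)[of _ _ 0 0] by simp_all

text \<open>For fixed \<open>x1\<close> and \<open>x2\<close> the operator \<open>br x1 x2\<close>
  is linear, so each linearity relation in \<open>(y1, y2)\<close> goes to a sum of two relations of
  the same kind, one for each slot acted on. The alternating relation goes to a symmetrised pair,
  covered by \<open>free_gen_skew\<close>.\<close>

lemma free_bracket_wedge_rel_right: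
  assumes "v \<in> wedge_rel s"
  shows "free_bracket br u v \<in> wedge_rel s"
  unfolding free_bracket_eq_free_lift
proof (rule free_lift_in_subspace[OF free.vector_space_axioms subspace_wedge_rel], clarify)
  fix x1 x2
  note rel = wedge_gens_in_wedge_rel[of _ s]
  define B where "B y1 y2 = (free_gen (br x1 x2 y1) y2 + free_gen y1 (br x1 x2 y2) :: 'v \<times> 'v \<Rightarrow>\<^sub>0 'k)"
    for y1 y2
  have "free_lift free_scale (\<lambda>(y1, y2). B y1 y2) v \<in> wedge_rel s"
  proof (rule free_lift_wedge_rel[OF free.vector_space_axioms subspace_wedge_rel _ _ _ _ _ assms])
    show "B (y + y') z - B y z - B y' z \<in> wedge_rel s" for y y' z
      using wedge_rel_add[OF rel[OF wedge_gens.add_left[of "br x1 x2 y" "br x1 x2 y'" z]]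
          rel[OF wedge_gens.add_left[of y y' "br x1 x2 z"]]]
      by (simp add: B_def br_simps algebra_simps)
    show "B y (z + z') - B y z - B y z' \<in> wedge_rel s" for y z z'
      using wedge_rel_add[OF rel[OF wedge_gens.add_right[of "br x1 x2 y" z z']]
          rel[OF wedge_gens.add_right[of y "br x1 x2 z" "br x1 x2 z'"]]]
      by (simp add: B_def br_simps algebra_simps)
    show "B (s c y) z - free_scale c (B y z) \<in> wedge_rel s" for c y z
      using wedge_rel_add[OF rel[OF wedge_gens.scale_left[of s c "br x1 x2 y" z]]
          rel[OF wedge_gens.scale_left[of s c y "br x1 x2 z"]]]
      by (simp add: B_def br_simps free.scale_right_distrib algebra_simps)
    show "B y (s c z) - free_scale c (B y z) \<in> wedge_rel s" for c y z
      using wedge_rel_add[OF rel[OF wedge_gens.scale_right[of "br x1 x2 y" s c z]]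
          rel[OF wedge_gens.scale_right[of y s c "br x1 x2 z"]]]
      by (simp add: B_def br_simps free.scale_right_distrib algebra_simps)
    show "B y y \<in> wedge_rel s" for y
      by (simp add: B_def free_gen_skew)
  qed
  then show "free_lift free_scale
      (\<lambda>(y1, y2). free_gen (br x1 x2 y1) y2 + free_gen y1 (br x1 x2 y2)) v \<in> wedge_rel s"
    by (simp add: B_def)
qed

lemma free_bracket_wedge_rel_left:
  assumes "u \<in> wedge_rel s"
  shows "free_bracket br u v \<in> wedge_rel s"
  unfolding free_bracket_eq_free_lift_swap
proof (rule free_lift_in_subspace[OF free.vector_space_axioms subspace_wedge_rel], clarify)
  fix y1 y2
  note rel = wedge_gens_in_wedge_rel[of _ s]
  define B where "B x1 x2 = (free_gen (br x1 x2 y1) y2 + free_gen y1 (br x1 x2 y2) :: 'v \<times> 'v \<Rightarrow>\<^sub>0 'k)"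
    for x1 x2
  \<comment> \<open>\<open>a\<close> and \<open>b\<close> stand for the values of \<open>br\<close>
    with \<open>y1\<close> and \<open>y2\<close> in the last slot. Both are linear in
    \<open>x1\<close> and in \<open>x2\<close>, so \<open>add\<close> and \<open>scale\<close> cover
    either argument.\<close>
  have add: "free_gen (a + a') y2 + free_gen y1 (b + b') - (free_gen a y2 + free_gen y1 b)
      - (free_gen a' y2 + free_gen y1 b') \<in> wedge_rel s" for a a' b b'
    using wedge_rel_add[OF rel[OF wedge_gens.add_left[of a a' y2]]
        rel[OF wedge_gens.add_right[of y1 b b']]]
    by (simp add: algebra_simps)
  have scale: "free_gen (s c a) y2 + free_gen y1 (s c b)
      - free_scale c (free_gen a y2 + free_gen y1 b) \<in> wedge_rel s" for c a b
    using wedge_rel_add[OF rel[OF wedge_gens.scale_left[of s c a y2]]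
        rel[OF wedge_gens.scale_right[of y1 s c b]]]
    by (simp add: free.scale_right_distrib algebra_simps)
  have "free_lift free_scale (\<lambda>(x1, x2). B x1 x2) u \<in> wedge_rel s"
  proof (rule free_lift_wedge_rel[OF free.vector_space_axioms subspace_wedge_rel _ _ _ _ _ assms])
    \<comment> \<open>Both brackets vanish, which leaves generators with a zero entry.\<close>
    show "B x x \<in> wedge_rel s" for x
      by (simp add: B_def br_simps wedge_rel_add free_gen_zero_left free_gen_zero_right vector_space)
  qed (simp_all add: B_def br_simps add scale)
  then show "free_lift free_scale
      (\<lambda>(x1, x2). free_gen (br x1 x2 y1) y2 + free_gen y1 (br x1 x2 y2)) u \<in> wedge_rel s"
    by (simp add: B_def)
qed

lemma F_bracket_wedge_class:
  "F_bracket s br (wedge_class s u) (wedge_class s v) = wedge_class s (free_bracket br u v)"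
proof -
  define u' where "u' = (SOME u'. u' \<in> wedge_class s u)"
  define v' where "v' = (SOME v'. v' \<in> wedge_class s v)"
  have "u' \<in> wedge_class s u" "v' \<in> wedge_class s v"
    unfolding u'_def v'_def by (rule someI, rule wedge_class_self)+
  \<comment> \<open>One representative is changed at a time: this sum telescopes to the difference
    of the two brackets.\<close>
  then have "free_bracket br (u' - u) v' + free_bracket br u (v' - v) \<in> wedge_rel s"
    by (simp add: mem_wedge_class wedge_rel_add free_bracket_wedge_rel_left
        free_bracket_wedge_rel_right)
  then have "free_bracket br u' v' - free_bracket br u v \<in> wedge_rel s"
    by (simp add: free_bracket_diff_left free_bracket_diff_right)
  then show ?thesis
    by (simp add: F_bracket_def wedge_class_eq_iff u'_def v'_def)
qed

lemma F_bracket_wedge: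
  "F_bracket s br (wedge s x1 x2) (wedge s y1 y2)
   = wedge s (br x1 x2 y1) y2 + wedge s y1 (br x1 x2 y2)"
  by (simp add: wedge_def F_bracket_wedge_class free_bracket_free_gen wedge_class_add)

end

section \<open>Crossed actions\<close>

text \<open>
  \<open>A x y\<close> stands for \<open>\<alpha> (x \<and> y) = l\<^sub>3(x, y, \<cdot>)\<close>.
\<close>

locale crossed_action =
  fixes s1 :: "'k::field \<Rightarrow> 'v1::ab_group_add \<Rightarrow> 'v1"
    and s0 :: "'k \<Rightarrow> 'v0::ab_group_add \<Rightarrow> 'v0"
    and d :: "'v1 \<Rightarrow> 'v0" and br and A :: "'v0 \<Rightarrow> 'v0 \<Rightarrow> 'v1 \<Rightarrow> 'v1"
  assumes linear_d: "Vector_Spaces.linear s1 s0 d"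
    and three_lie: "three_lie_algebra s0 br"
    and linear_A1: "Vector_Spaces.linear s0 s1 (\<lambda>x. A x y f)"
    and linear_A2: "Vector_Spaces.linear s0 s1 (\<lambda>y. A x y f)"
    and linear_A3: "Vector_Spaces.linear s1 s1 (A x y)"
    and A_same: "A x x f = 0"
    and d_A: "d (A x y f) = br x y (d f)"
    and A_d: "A x (d f) g = - A x (d g) f"
    and A_A: "A x1 x2 (A y1 y2 f)
      = A (br x1 x2 y1) y2 f + A y1 (br x1 x2 y2) f + A y1 y2 (A x1 x2 f)"
    and A_br: "A x (br y1 y2 y3) f
      = A y2 y3 (A x y1 f) - A y1 y3 (A x y2 f) + A y1 y2 (A x y3 f)"

definition pullback_bracket ::
    "('v1 \<Rightarrow> 'v0) \<Rightarrow> ('v0 \<Rightarrow> 'v0 \<Rightarrow> 'v1 \<Rightarrow> 'v1) \<Rightarrow> 'v1 \<Rightarrow> 'v1 \<Rightarrow> 'v1 \<Rightarrow> 'v1" where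
  "pullback_bracket d A f g h = A (d f) (d g) h"

text \<open>Restricted to \<open>ext_square s0\<close> because representations are extensional
  there, so that equal actions are equal functions. \<open>act_wedge_rel\<close> justifies the
  arbitrary representative.\<close>

definition ext_action ::
    "('k::field \<Rightarrow> 'v1::ab_group_add \<Rightarrow> 'v1) \<Rightarrow> ('k \<Rightarrow> 'v0::ab_group_add \<Rightarrow> 'v0) \<Rightarrow>
     ('v0 \<Rightarrow> 'v0 \<Rightarrow> 'v1 \<Rightarrow> 'v1) \<Rightarrow> ('v0 \<times> 'v0 \<Rightarrow>\<^sub>0 'k) set \<Rightarrow> 'v1 \<Rightarrow> 'v1" where
  "ext_action s1 s0 A =
     (\<lambda>X\<in>ext_square s0. \<lambda>f. free_lift s1 (\<lambda>(x, y). A x y f) (SOME u. u \<in> X))"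

text \<open>Even permutations carry the single argument from \<open>V1\<close> to the last place,
  hence the cyclic sum. Terms with two components from \<open>V1\<close> are absent, as condition
  (b) prescribes.\<close>

definition total_bracket ::
    "('v0 \<Rightarrow> 'v0 \<Rightarrow> 'v0 \<Rightarrow> 'v0) \<Rightarrow> ('v0 \<Rightarrow> 'v0 \<Rightarrow> 'v1 \<Rightarrow> 'v1::ab_group_add) \<Rightarrow>
     'v0 \<times> 'v1 \<Rightarrow> 'v0 \<times> 'v1 \<Rightarrow> 'v0 \<times> 'v1 \<Rightarrow> 'v0 \<times> 'v1" where
  "total_bracket br A X Y Z =
     (br (fst X) (fst Y) (fst Z),
      A (fst X) (fst Y) (snd Z) + A (fst Y) (fst Z) (snd X) + A (fst Z) (fst X) (snd Y))"

definition bracket_part ::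
    "('v0 \<times> 'v1::zero \<Rightarrow> 'v0 \<times> 'v1 \<Rightarrow> 'v0 \<times> 'v1 \<Rightarrow> 'v0 \<times> 'v1) \<Rightarrow> 'v0 \<Rightarrow> 'v0 \<Rightarrow> 'v0 \<Rightarrow> 'v0" where
  "bracket_part l x y z = fst (l (in0 x) (in0 y) (in0 z))"

definition action_part ::
    "('v0::zero \<times> 'v1::zero \<Rightarrow> 'v0 \<times> 'v1 \<Rightarrow> 'v0 \<times> 'v1 \<Rightarrow> 'v0 \<times> 'v1) \<Rightarrow> 'v0 \<Rightarrow> 'v0 \<Rightarrow> 'v1 \<Rightarrow> 'v1" where
  "action_part l x y f = snd (l (in0 x) (in0 y) (in1 f))"

context crossed_action
begin

sublocale V1: vector_space s1
  using linear_d by (simp add: Vector_Spaces.linear_iff)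

sublocale V0: vector_space s0
  using linear_d by (simp add: Vector_Spaces.linear_iff)

sublocale br: skew_trilinear s0 br
  using three_lie by unfold_locales (simp_all add: three_lie_algebra_def)

sublocale d: module_hom s1 s0 d
  using linear_d by (rule module_hom_linearI)

lemma A_add: "A (x + x') y f = A x y f + A x' y f" "A x (y + y') f = A x y f + A x y' f"
  "A x y (f + f') = A x y f + A x y f'"
  and A_scale: "A (s0 c x) y f = s1 c (A x y f)" "A x (s0 c y) f = s1 c (A x y f)"
  "A x y (s1 c f) = s1 c (A x y f)"
  using linear_A1 linear_A2 linear_A3 by (auto simp: Vector_Spaces.linear_iff)

lemma A_zero: "A 0 y f = 0" "A x 0 f = 0" "A x y 0 = 0"
  using A_add(1)[of 0 0] A_add(2)[of _ 0 0] A_add(3)[of _ _ 0 0] by simp_all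

lemma A_swap: "A y x f = - A x y f"
  using A_same[of "x + y" f, unfolded A_add]
  by (simp add: A_same eq_neg_iff_add_eq_0 add.commute)

section \<open>From a crossed action to a crossed module\<close>

abbreviation act where "act u f \<equiv> free_lift s1 (\<lambda>(x, y). A x y f) u"

lemma act_wedge_rel:
  assumes "u \<in> wedge_rel s0"
  shows "act u f = 0"
proof -
  have "act u f \<in> {0}"
    by (rule free_lift_wedge_rel[OF V1.vector_space_axioms _ _ _ _ _ _ assms])
      (simp_all add: A_add A_scale A_same V1.subspace_single_0)
  then show ?thesis by simp
qed

lemma ext_action_wedge_class: "ext_action s1 s0 A (wedge_class s0 u) = act u"
proof
  fix f
  define v where "v = (SOME v. v \<in> wedge_class s0 u)"
  have "v \<in> wedge_class s0 u"
    unfolding v_def by (rule someI, rule wedge_class_self)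
  then have "act (v - u) f = 0"
    by (intro act_wedge_rel) (simp add: mem_wedge_class)
  then show "ext_action s1 s0 A (wedge_class s0 u) f = act u f"
    by (simp add: ext_action_def V1.free_lift_diff v_def)
qed

lemma ext_action_wedge: "ext_action s1 s0 A (wedge s0 x y) = A x y"
  by (simp add: wedge_def ext_action_wedge_class free_gen_def V1.free_lift_single fun_eq_iff)

lemma linear_act: "Vector_Spaces.linear s1 s1 (act u)"
  using V1.linear_free_lift_fun[OF V1.vector_space_axioms, of "\<lambda>(x, y). A x y" u] linear_A3
  by (simp add: case_prod_unfold)

lemma A_commutator:
  "A x1 x2 (A y1 y2 f) - A y1 y2 (A x1 x2 f) = A (br x1 x2 y1) y2 f + A y1 (br x1 x2 y2) f"
  by (subst A_A) simp

text \<open>Expansion over representatives reduces the claim to pairs of generators, where it is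
  \<open>A_commutator\<close>.\<close>

lemma act_act_commutator: "act u (act v f) - act v (act u f) = act (free_bracket br u v) f"
proof -
  have A_act: "A x y (free_lift s1 (\<lambda>q. A (fst q) (snd q) f) v)
      = free_lift s1 (\<lambda>q. A x y (A (fst q) (snd q) f)) v" for x y v
    by (rule linear_free_lift_commute[OF linear_A3])
  have "act u (act v f) - act v (act u f)
      = free_lift s1 (\<lambda>(x1, x2). free_lift s1 (\<lambda>(y1, y2). A x1 x2 (A y1 y2 f)) v) u
      - free_lift s1 (\<lambda>(y1, y2). free_lift s1 (\<lambda>(x1, x2). A y1 y2 (A x1 x2 f)) u) v"
    by (simp add: A_act case_prod_unfold)
  \<comment> \<open>The two products expand in opposite orders; exchanging the sums in the second
    lets them be subtracted term by term.\<close>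
  also have "free_lift s1 (\<lambda>(y1, y2). free_lift s1 (\<lambda>(x1, x2). A y1 y2 (A x1 x2 f)) u) v
      = free_lift s1 (\<lambda>(x1, x2). free_lift s1 (\<lambda>(y1, y2). A y1 y2 (A x1 x2 f)) v) u"
    unfolding case_prod_unfold by (rule V1.free_lift_commute)
  also have "free_lift s1 (\<lambda>(x1, x2). free_lift s1 (\<lambda>(y1, y2). A x1 x2 (A y1 y2 f)) v) u
      - free_lift s1 (\<lambda>(x1, x2). free_lift s1 (\<lambda>(y1, y2). A y1 y2 (A x1 x2 f)) v) u
      = free_lift s1 (\<lambda>(x1, x2). free_lift s1 (\<lambda>(y1, y2).
          A x1 x2 (A y1 y2 f) - A y1 y2 (A x1 x2 f)) v) u"
    by (simp add: V1.free_lift_fun_diff case_prod_unfold)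
  also have "\<dots> = free_lift s1 (\<lambda>(x1, x2). free_lift s1 (\<lambda>(y1, y2).
      A (br x1 x2 y1) y2 f + A y1 (br x1 x2 y2) f) v) u"
    by (simp only: A_commutator)
  also have "\<dots> = act (free_bracket br u v) f"
    by (simp add: free_bracket_eq_free_lift linear_free_lift_commute[OF V1.linear_free_lift]
        case_prod_unfold V1.free_lift_add free_gen_def V1.free_lift_single)
  finally show ?thesis .
qed

text \<open>Equivariance \<open>d_A\<close> identifies \<open>br x y (d f)\<close> with
  \<open>d (A x y f)\<close>, so the commutator rule \<open>A_A\<close> becomes the Leibniz
  rule.\<close>

lemma A_pullback_bracket:
  "A x y (pullback_bracket d A f g h) =
     pullback_bracket d A (A x y f) g h + pullback_bracket d A f (A x y g) h
     + pullback_bracket d A f g (A x y h)"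
  unfolding pullback_bracket_def d_A by (rule A_A)

lemma trilinear_pullback_bracket: "trilinear s1 (pullback_bracket d A)"
  by (auto simp: trilinear_def Vector_Spaces.linear_iff V1.vector_space_axioms
      pullback_bracket_def d.add d.scale A_add A_scale)

text \<open>
  In characteristic 2 the relation \<open>A x (d f) g = - A x (d g) f\<close> does not give \<open>A x (d f) f = 0\<close>
  for arbitrary \<open>x\<close>, but it suffices when \<open>x\<close> is itself in the image of \<open>d\<close>.
\<close>

lemma fully_skew_pullback_bracket: "fully_skew (pullback_bracket d A)"
proof -
  have "A (d f) (d g) g = 0" for f g
    using A_d[of "d g" f g] by (simp add: A_swap[of "d f" "d g"] A_same)
  moreover have "A (d g) (d f) g = 0" for f g
    using A_d[of "d g" f g] by (simp add: A_same)
  ultimately show ?thesis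
    by (simp add: fully_skew_def pullback_bracket_def A_same)
qed

text \<open>The fundamental identity is the Leibniz rule for the operator
  \<open>A (d f1) (d f2)\<close>.\<close>

lemma three_lie_pullback_bracket: "three_lie_algebra s1 (pullback_bracket d A)"
proof -
  let ?b = "pullback_bracket d A"
  have "?b f1 f2 (?b f3 f4 f5) = ?b (?b f1 f2 f3) f4 f5 + ?b f3 (?b f1 f2 f4) f5
      + ?b f3 f4 (?b f1 f2 f5)" for f1 f2 f3 f4 f5
    using A_pullback_bracket[of "d f1" "d f2" f3 f4 f5] by (simp only: pullback_bracket_def)
  then show ?thesis
    unfolding three_lie_algebra_def
    using V1.vector_space_axioms trilinear_pullback_bracket fully_skew_pullback_bracket by blast
qed

text \<open>Each \<open>A x y\<close> is a derivation, and trilinearity pulls the sum over the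
  representative out of every slot.\<close>

lemma act_in_Der: "act u \<in> Der s1 (pullback_bracket d A)"
proof -
  let ?b = "pullback_bracket d A"
  have lin: "Vector_Spaces.linear s1 s1 (\<lambda>f. ?b f g h)" "Vector_Spaces.linear s1 s1 (\<lambda>g. ?b f g h)"
    "Vector_Spaces.linear s1 s1 (\<lambda>h. ?b f g h)" for f g h
    using trilinear_pullback_bracket by (simp_all add: trilinear_def)
  have "act u (?b f g h) = ?b (act u f) g h + ?b f (act u g) h + ?b f g (act u h)" for f g h
    by (simp add: lin[THEN linear_free_lift_commute] case_prod_unfold A_pullback_bracket
        V1.free_lift_fun_add)
  then show ?thesis
    by (simp add: Der_def linear_act)
qed

lemma three_lie_rep_ext_action: "three_lie_rep s0 br s1 (ext_action s1 s0 A)"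
  unfolding three_lie_rep_def
proof (intro conjI ballI allI)
  show "ext_action s1 s0 A \<in> ext_square s0 \<rightarrow>\<^sub>E {T. Vector_Spaces.linear s1 s1 T}"
  proof (rule PiE_I)
    show "ext_action s1 s0 A X \<in> {T. Vector_Spaces.linear s1 s1 T}" if "X \<in> ext_square s0" for X
      using that by (rule ext_squareE) (simp add: ext_action_wedge_class linear_act)
  qed (simp add: ext_action_def)
next
  fix X Y assume "X \<in> ext_square s0" "Y \<in> ext_square s0"
  then obtain u v where [simp]: "X = wedge_class s0 u" "Y = wedge_class s0 v"
    by (auto elim!: ext_squareE)
  show "ext_action s1 s0 A (X + Y) = (\<lambda>f. ext_action s1 s0 A X f + ext_action s1 s0 A Y f)"
    by (simp add: wedge_class_add ext_action_wedge_class V1.free_lift_add)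
  show "(\<lambda>f. ext_action s1 s0 A X (ext_action s1 s0 A Y f)
      - ext_action s1 s0 A Y (ext_action s1 s0 A X f))
    = ext_action s1 s0 A (F_bracket s0 br X Y)"
    by (simp add: br.F_bracket_wedge_class ext_action_wedge_class act_act_commutator)
next
  fix c X assume "X \<in> ext_square s0"
  then show "ext_action s1 s0 A (ext_scale s0 c X) = (\<lambda>f. s1 c (ext_action s1 s0 A X f))"
    by (rule ext_squareE)
      (simp add: ext_scale_wedge_class ext_action_wedge_class V1.free_lift_scale)
qed (simp_all add: ext_action_wedge A_br fun_eq_iff V1.vector_space_axioms)

lemma crossed_module_ext_action:
  "crossed_module s1 s0 (pullback_bracket d A) br d (ext_action s1 s0 A)"
  unfolding crossed_module_def
proof (intro conjI)
  show "three_lie_hom s1 (pullback_bracket d A) s0 br d"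
    by (simp add: three_lie_hom_def linear_d pullback_bracket_def d_A)
  show "\<forall>X\<in>ext_square s0. ext_action s1 s0 A X \<in> Der s1 (pullback_bracket d A)"
    by (auto elim!: ext_squareE simp: ext_action_wedge_class act_in_Der)
  show "\<forall>x f g. ext_action s1 s0 A (wedge s0 x (d f)) g = - ext_action s1 s0 A (wedge s0 x (d g)) f"
    unfolding ext_action_wedge using A_d by blast
qed (simp_all add: three_lie_pullback_bracket three_lie three_lie_rep_ext_action ext_action_wedge d_A
    pullback_bracket_def)

section \<open>From a crossed action to a strict 3-Lie 2-algebra\<close>

lemma total_bracket_simps:
  "total_bracket br A (in0 x) (in0 y) (in0 z) = in0 (br x y z)"
  "total_bracket br A (in0 x) (in0 y) (in1 f) = in1 (A x y f)"
  "total_bracket br A (in0 x) (in1 f) (in0 y) = in1 (A y x f)"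
  "total_bracket br A (in1 f) (in0 x) (in0 y) = in1 (A x y f)"
  "total_bracket br A (in1 f) (in1 g) X = 0"
  by (simp_all add: total_bracket_def in0_def in1_def A_zero br.br_zero zero_prod_def)

lemma bracket_part_total_bracket: "bracket_part (total_bracket br A) = br"
  by (intro ext) (simp only: bracket_part_def total_bracket_simps, simp add: in0_def)

lemma action_part_total_bracket: "action_part (total_bracket br A) = A"
  by (intro ext) (simp only: action_part_def total_bracket_simps, simp add: in1_def)

sublocale total: vector_space_prod s0 s1 ..

lemma trilinear_total_bracket: "trilinear (module_prod.scale s0 s1) (total_bracket br A)"
  by (simp add: trilinear_def Vector_Spaces.linear_iff total.p.vector_space_axioms total_bracket_def
      total.scale_def br.br_simps A_add A_scale V1.scale_right_distrib)

lemma fully_skew_total_bracket: "fully_skew (total_bracket br A)"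
proof -
  have "A x y f + A y x f = 0" for x y f
    by (simp add: A_swap[of x y])
  then show ?thesis
    by (simp add: fully_skew_def total_bracket_def br.br_simps A_same zero_prod_def)
qed

lemma strict_total_bracket: "strict_three_lie_two_algebra s1 s0 d (total_bracket br A)"
proof -
  have in01: "in0 x + in0 y = (in0 (x + y) :: 'v0 \<times> 'v1)" "in1 f + in1 g = (in1 (f + g) :: 'v0 \<times> 'v1)"
    for x y f g
    by (simp_all add: in0_def in1_def)
  \<comment> \<open>The unnamed facts from here on are conditions (d), (e), (f), (c) and (a), in
    this order, with the injections removed; \<open>fact\<close> matches them at the end.\<close>
  have "br x1 x2 (br x3 x4 x5)
      = br (br x1 x2 x3) x4 x5 + br x3 (br x1 x2 x4) x5 + br x3 x4 (br x1 x2 x5)"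
    for x1 x2 x3 x4 x5
    using three_lie unfolding three_lie_algebra_def by blast
  have "A x2 (br x3 x4 x5) f
      = A x4 x5 (A x2 x3 f) + A x5 x3 (A x2 x4 f) + A x3 x4 (A x2 x5 f)" for x2 x3 x4 x5 f
    by (simp add: A_br A_swap[of x5 x3])
  have "A x1 x2 (A x4 x5 f)
      = A x4 x5 (A x1 x2 f) + A (br x1 x2 x4) x5 f + A x4 (br x1 x2 x5) f" for x1 x2 x4 x5 f
    by (subst A_A) (simp add: algebra_simps)
  have "A x (d f) g = A (d g) x f" for x f g
    by (simp add: A_d[of x f g] A_swap[of "d g" x])
  have "d (snd (in1 (A x y f) :: 'v0 \<times> 'v1)) = br x y (d f)" for x y f
    by (simp add: in1_def d_A)
  show ?thesis
    unfolding strict_three_lie_two_algebra_def total_bracket_simps in01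
    by (intro conjI allI linear_d trilinear_total_bracket fully_skew_total_bracket)
      (rule rangeI refl arg_cong[of _ _ in0] arg_cong[of _ _ in1] | fact)+
qed

end

section \<open>Recovering a crossed action from either structure\<close>

lemma crossed_action_of_crossed_module:
  assumes "crossed_module s1 s0 brg brh \<mu> \<alpha>"
  defines "A \<equiv> \<lambda>x y. \<alpha> (wedge s0 x y)"
  shows "crossed_action s1 s0 \<mu> brh A" and "pullback_bracket \<mu> A = brg"
    and "ext_action s1 s0 A = \<alpha>"
proof -
  note cm = assms(1)[unfolded crossed_module_def]
  have h: "three_lie_algebra s0 brh" and \<mu>: "Vector_Spaces.linear s1 s0 \<mu>"
    and rep: "three_lie_rep s0 brh s1 \<alpha>"
    using cm by (simp_all add: three_lie_hom_def)
  have \<mu>_\<alpha>: "\<forall>x y f. \<mu> (\<alpha> (wedge s0 x y) f) = brh x y (\<mu> f)"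
    using cm by (elim conjE) assumption
  have \<alpha>_\<mu>_\<mu>: "\<forall>f g h. \<alpha> (wedge s0 (\<mu> f) (\<mu> g)) h = brg f g h"
    using cm by (elim conjE) assumption
  have \<alpha>_\<mu>: "\<forall>x f g. \<alpha> (wedge s0 x (\<mu> f)) g = - \<alpha> (wedge s0 x (\<mu> g)) f"
    using cm by (elim conjE) assumption
  interpret V1: vector_space s1
    using rep by (simp add: three_lie_rep_def)
  interpret V0: vector_space s0
    using h by (simp add: three_lie_algebra_def)
  interpret br: skew_trilinear s0 brh
    using h by unfold_locales (simp_all add: three_lie_algebra_def)
  have lin: "Vector_Spaces.linear s1 s1 (\<alpha> X)" if "X \<in> ext_square s0" for X
    using rep that by (auto simp: three_lie_rep_def)
  have add: "\<alpha> (X + Y) f = \<alpha> X f + \<alpha> Y f" if "X \<in> ext_square s0" "Y \<in> ext_square s0" for X Y f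
    using rep that by (simp add: three_lie_rep_def)
  have scale: "\<alpha> (ext_scale s0 c X) f = s1 c (\<alpha> X f)" if "X \<in> ext_square s0" for c X f
    using rep that by (simp add: three_lie_rep_def)
  have comm: "\<alpha> X (\<alpha> Y f) - \<alpha> Y (\<alpha> X f) = \<alpha> (F_bracket s0 brh X Y) f"
    if "X \<in> ext_square s0" "Y \<in> ext_square s0" for X Y f
    proof -
    have "(\<lambda>f. \<alpha> X (\<alpha> Y f) - \<alpha> Y (\<alpha> X f)) = \<alpha> (F_bracket s0 brh X Y)"
      using rep that by (simp add: three_lie_rep_def)
    then show ?thesis by (rule fun_cong)
  qed
  \<comment> \<open>The zero coset is \<open>0\<close> times itself. This gives
    \<open>A x x f = 0\<close>, since \<open>wedge s0 x x\<close> is the zero coset.\<close>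
  have zero: "\<alpha> (wedge_class s0 0) f = 0" for f
    using scale[of "wedge_class s0 0" 0 f] by (simp add: ext_scale_wedge_class)
  show crossed: "crossed_action s1 s0 \<mu> brh A"
  proof (rule crossed_action.intro)
    \<comment> \<open>The commutator axiom of the representation, read on two decomposable
      elements.\<close>
    show "A x1 x2 (A y1 y2 f)
        = A (brh x1 x2 y1) y2 f + A y1 (brh x1 x2 y2) f + A y1 y2 (A x1 x2 f)" for x1 x2 y1 y2 f
      using comm[of "wedge s0 x1 x2" "wedge s0 y1 y2" f]
      by (simp add: A_def br.F_bracket_wedge add algebra_simps)
    show "A x (brh y1 y2 y3) f
        = A y2 y3 (A x y1 f) - A y1 y3 (A x y2 f) + A y1 y2 (A x y3 f)" for x y1 y2 y3 f
      using rep unfolding A_def three_lie_rep_def by metis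
    show "A x (\<mu> f) g = - A x (\<mu> g) f" for x f g
      unfolding A_def using \<alpha>_\<mu> by blast
    show "Vector_Spaces.linear s0 s1 (\<lambda>x. A x y f)" "Vector_Spaces.linear s0 s1 (\<lambda>y. A x y f)"
      for x y f
      by (simp_all add: Vector_Spaces.linear_iff V0.vector_space_axioms V1.vector_space_axioms A_def
          wedge_add_left wedge_add_right wedge_scale_left wedge_scale_right add scale)
  qed (simp_all add: h \<mu> lin A_def wedge_alternating zero \<mu>_\<alpha>)
  show "pullback_bracket \<mu> A = brg"
    by (simp add: fun_eq_iff pullback_bracket_def A_def \<alpha>_\<mu>_\<mu>)
  interpret crossed_action s1 s0 \<mu> brh A by (rule crossed)
  show "ext_action s1 s0 A = \<alpha>"
  proof (rule PiE_ext)
    show "ext_action s1 s0 A \<in> ext_square s0 \<rightarrow>\<^sub>E {T. Vector_Spaces.linear s1 s1 T}"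
      using three_lie_rep_ext_action by (simp add: three_lie_rep_def)
    show "\<alpha> \<in> ext_square s0 \<rightarrow>\<^sub>E {T. Vector_Spaces.linear s1 s1 T}"
      using rep by (simp add: three_lie_rep_def)
    fix X assume "X \<in> ext_square s0"
    then obtain u where X: "X = wedge_class s0 u"
      by (rule ext_squareE)
    have "\<alpha> X f = act u f" for f
    proof -
      \<comment> \<open>Pulled back to the free space, \<open>\<alpha>\<close> is linear and hence
        determined by the generators, where it is \<open>A\<close>.\<close>
      have "Vector_Spaces.linear free_scale s1 (\<lambda>u. \<alpha> (wedge_class s0 u) f)"
        by (simp add: Vector_Spaces.linear_iff free.vector_space_axioms V1.vector_space_axioms
            wedge_class_add[symmetric] ext_scale_wedge_class[symmetric] add scale)
      from linear_free_lift_commute[OF this, of "\<lambda>p. Poly_Mapping.single p 1" u]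
      show ?thesis
        by (simp add: X free_poly_eq_free_lift[symmetric] A_def wedge_def free_gen_def
            case_prod_unfold)
    qed
    then show "ext_action s1 s0 A X = \<alpha> X"
      by (simp add: X ext_action_wedge_class fun_eq_iff)
  qed
qed

text \<open>Condition (b) and the sign rules reduce \<open>l\<close> to \<open>br\<close> and
  \<open>A\<close>. The remaining conditions become the axioms of a crossed action once the
  injections are cancelled.\<close>

lemma crossed_action_of_strict:
  assumes V1: "vector_space s1" and V0: "vector_space s0"
    and strict: "strict_three_lie_two_algebra s1 s0 d l"
  defines "br \<equiv> bracket_part l" and "A \<equiv> action_part l"
  shows "crossed_action s1 s0 d br A" and "total_bracket br A = l"
    and "l (in0 x) (in0 y) (in0 z) = in0 (br x y z)"
    and "l (in0 x) (in0 y) (in1 f) = in1 (A x y f)"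
proof -
  note st = strict[unfolded strict_three_lie_two_algebra_def]
  interpret total: vector_space_prod s0 s1
    using V0 V1 by (rule vector_space_prod.intro[OF vector_space_pair.intro])
  interpret l: skew_trilinear "module_prod.scale s0 s1" l
    using st by unfold_locales simp_all
  show l000: "l (in0 x) (in0 y) (in0 z) = in0 (br x y z)" for x y z
  proof -
    have "l (in0 x) (in0 y) (in0 z) \<in> in0 ` UNIV" using st by (elim conjE allE) assumption
    then show ?thesis by (auto simp: br_def bracket_part_def in0_def)
  qed
  show l001: "l (in0 x) (in0 y) (in1 f) = in1 (A x y f)" for x y f
  proof -
    have "l (in0 x) (in0 y) (in1 f) \<in> in1 ` UNIV" using st by (elim conjE allE) assumption
    then show ?thesis by (auto simp: A_def action_part_def in1_def)
  qed
  \<comment> \<open>Cyclic shifts are even, so they bring the argument from \<open>V1\<close> to the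
    last place without a sign.\<close>
  have l100: "l (in1 f) (in0 x) (in0 y) = in1 (A x y f)" for x y f
    using l.br_rotate[of "in0 x" "in0 y" "in1 f"] l001 by simp
  have l010: "l (in0 x) (in1 f) (in0 y) = in1 (A y x f)" for x y f
    using l.br_rotate[of "in0 x" "in1 f" "in0 y"] l001 by simp
  have l111: "l (in1 f) (in1 g) (in1 h) = 0" for f g h
    using st by (elim conjE allE) assumption
  have l110: "l (in1 f) (in1 g) (in0 x) = 0" for f g x
    using st by (elim conjE allE) assumption
  have l101: "l (in1 f) (in0 x) (in1 g) = 0" for f g x
    by (rule trans[OF l.br_rotate l110])
  have l011: "l (in0 x) (in1 f) (in1 g) = 0" for f g x
    by (rule trans[OF l.br_rotate l101])
  note l_simps = l000 l001 l100 l010 l111 l110 l101 l011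
  have split: "X = in0 (fst X) + in1 (snd X)" for X :: "'c \<times> 'b"
    by (simp add: in0_def in1_def)
  \<comment> \<open>Trilinearity gives eight terms. Those with at least two arguments from
    \<open>V1\<close> vanish; the other four are the components of
    \<open>total_bracket\<close>.\<close>
  have "l (in0 x + in1 f) (in0 y + in1 g) (in0 z + in1 h)
      = total_bracket br A (in0 x + in1 f) (in0 y + in1 g) (in0 z + in1 h)" for x y z f g h
    by (simp only: l.br_simps l_simps) (simp add: total_bracket_def in0_def in1_def)
  then have "l X Y Z = total_bracket br A X Y Z" for X Y Z
    by (metis split)
  then show "total_bracket br A = l"
    by (simp add: fun_eq_iff)
  have in0_add: "in0 (x + y) = (in0 x + in0 y :: 'c \<times> 'b)"
    and in1_add: "in1 (f + g) = (in1 f + in1 g :: 'c \<times> 'b)"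
    and in0_scale: "in0 (s0 c x) = module_prod.scale s0 s1 c (in0 x)"
    and in1_scale: "in1 (s1 c f) = module_prod.scale s0 s1 c (in1 f)" for x y f g c
    by (simp_all add: in0_def in1_def total.scale_def)
  have in0_inj: "in0 x = (in0 y :: 'c \<times> 'b) \<longleftrightarrow> x = y"
    and in1_inj: "in1 f = (in1 g :: 'c \<times> 'b) \<longleftrightarrow> f = g" for x y f g
    by (simp_all add: in0_def in1_def)
  have br_lin: "br (x + x') y z = br x y z + br x' y z" "br x (y + y') z = br x y z + br x y' z"
    "br x y (z + z') = br x y z + br x y z'" "br (s0 c x) y z = s0 c (br x y z)"
    "br x (s0 c y) z = s0 c (br x y z)" "br x y (s0 c z) = s0 c (br x y z)" for x x' y y' z z' c
    unfolding br_def bracket_part_def 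
    by (simp_all only: in0_add in0_scale l.br_simps) (simp_all add: total.scale_def)
  have br_skew: "fully_skew br"
    by (simp add: fully_skew_def br_def bracket_part_def l.br_simps)
  have A_lin: "A (x + x') y f = A x y f + A x' y f" "A x (y + y') f = A x y f + A x y' f"
    "A x y (f + f') = A x y f + A x y f'" "A (s0 c x) y f = s1 c (A x y f)"
    "A x (s0 c y) f = s1 c (A x y f)" "A x y (s1 c f) = s1 c (A x y f)" for x x' y y' f f' c
    unfolding A_def action_part_def
    by (simp_all only: in0_add in1_add in0_scale in1_scale l.br_simps)
      (simp_all add: total.scale_def)
  have A_same: "A x x f = 0" for x f
    by (simp add: A_def action_part_def l.br_simps)
  have A_swap: "A y x f = - A x y f" for x y f
    unfolding A_def action_part_def by (subst l.br_swap12) simp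
  have d_A: "d (A x y f) = br x y (d f)" for x y f
  proof -
    have "in0 (d (snd (l (in0 x) (in0 y) (in1 f)))) = l (in0 x) (in0 y) (in0 (d f))"
      using st by (elim conjE allE) assumption
    then show ?thesis by (simp add: l000 in0_inj A_def action_part_def)
  qed
  have A_d: "A x (d f) g = - A x (d g) f" for x f g
  proof -
    have "l (in0 (d f)) (in1 g) (in0 x) = l (in1 f) (in0 (d g)) (in0 x)"
      using st by (elim conjE allE) assumption
    \<comment> \<open>Condition (c) reads \<open>A x (d f) g = A (d g) x f\<close>; skew-symmetry of
      \<open>A\<close> supplies the sign.\<close>
    then show ?thesis by (simp add: l_simps in1_inj A_swap[of x])
  qed
  have fundamental: "br x1 x2 (br x3 x4 x5)
      = br (br x1 x2 x3) x4 x5 + br x3 (br x1 x2 x4) x5 + br x3 x4 (br x1 x2 x5)"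
    for x1 x2 x3 x4 x5
  proof -
    have "l (in0 x1) (in0 x2) (l (in0 x3) (in0 x4) (in0 x5))
        = l (l (in0 x1) (in0 x2) (in0 x3)) (in0 x4) (in0 x5)
        + l (in0 x3) (l (in0 x1) (in0 x2) (in0 x4)) (in0 x5)
        + l (in0 x3) (in0 x4) (l (in0 x1) (in0 x2) (in0 x5))"
      using st by (elim conjE allE) assumption
    then show ?thesis by (simp add: l_simps in0_inj in0_add[symmetric])
  qed
  have A_br: "A x (br y1 y2 y3) f
      = A y2 y3 (A x y1 f) - A y1 y3 (A x y2 f) + A y1 y2 (A x y3 f)" for x y1 y2 y3 f
  proof -
    \<comment> \<open>Condition (e). Its middle term becomes \<open>A y3 y1 (A x y2 f)\<close>,
      whose swap accounts for the minus sign in \<open>A_br\<close>.\<close>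
    have "l (in1 f) (in0 x) (l (in0 y1) (in0 y2) (in0 y3))
        = l (l (in1 f) (in0 x) (in0 y1)) (in0 y2) (in0 y3)
        + l (in0 y1) (l (in1 f) (in0 x) (in0 y2)) (in0 y3)
        + l (in0 y1) (in0 y2) (l (in1 f) (in0 x) (in0 y3))"
      using st by (elim conjE allE) assumption
    then show ?thesis by (simp add: l_simps in1_inj in1_add[symmetric] A_swap[of y3 y1])
  qed
  have A_A: "A x1 x2 (A y1 y2 f)
      = A (br x1 x2 y1) y2 f + A y1 (br x1 x2 y2) f + A y1 y2 (A x1 x2 f)" for x1 x2 y1 y2 f
  proof -
    have "l (in0 x1) (in0 x2) (l (in1 f) (in0 y1) (in0 y2))
        = l (l (in0 x1) (in0 x2) (in1 f)) (in0 y1) (in0 y2)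
        + l (in1 f) (l (in0 x1) (in0 x2) (in0 y1)) (in0 y2)
        + l (in1 f) (in0 y1) (l (in0 x1) (in0 x2) (in0 y2))"
      using st by (elim conjE allE) assumption
    then show ?thesis by (simp add: l_simps in1_inj in1_add[symmetric] algebra_simps)
  qed
  have "trilinear s0 br"
    by (simp add: trilinear_def Vector_Spaces.linear_iff V0 br_lin)
  then have h: "three_lie_algebra s0 br"
    using V0 br_skew fundamental unfolding three_lie_algebra_def by blast
  show "crossed_action s1 s0 d br A"
  proof (rule crossed_action.intro)
    show "Vector_Spaces.linear s1 s0 d" using st by (elim conjE allE) assumption
    show "Vector_Spaces.linear s0 s1 (\<lambda>x. A x y f)" "Vector_Spaces.linear s0 s1 (\<lambda>y. A x y f)"
      "Vector_Spaces.linear s1 s1 (A x y)" for x y f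
      by (simp_all add: Vector_Spaces.linear_iff V0 V1 A_lin)
  qed (fact h A_same d_A A_d A_A A_br)+
qed

text \<open>Both sets consist of structures on the same two vector spaces. The second conjunct fixes
  the map, both brackets and \<open>\<alpha>\<close> on wedges, so the bijection is the intended
  correspondence and not a mere equality of cardinals.\<close>

theorem theorem5p4:
  fixes s1 :: "'k::field \<Rightarrow> 'v1::ab_group_add \<Rightarrow> 'v1"
    and s0 :: "'k \<Rightarrow> 'v0::ab_group_add \<Rightarrow> 'v0"
  assumes "vector_space s1" and "vector_space s0"
  shows "\<exists>\<Phi>.
    bij_betw \<Phi>
      {(d, l). strict_three_lie_two_algebra s1 s0 d l}
      {(brg, brh, \<mu>, \<alpha>). crossed_module s1 s0 brg brh \<mu> \<alpha>} \<and>
    (\<forall>d l brg brh \<mu> \<alpha>.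
      strict_three_lie_two_algebra s1 s0 d l \<longrightarrow> \<Phi> (d, l) = (brg, brh, \<mu>, \<alpha>) \<longrightarrow>
        \<mu> = d \<and>
        (\<forall>f g h. in1 (brg f g h) = l (in0 (d f)) (in0 (d g)) (in1 h)) \<and>
        (\<forall>x y z. in0 (brh x y z) = l (in0 x) (in0 y) (in0 z)) \<and>
        (\<forall>x y f. in1 (\<alpha> (wedge s0 x y) f) = l (in0 x) (in0 y) (in1 f)))"
proof -
  define \<Phi> where "\<Phi> = (\<lambda>(d :: 'v1 \<Rightarrow> 'v0,
      l :: 'v0 \<times> 'v1 \<Rightarrow> 'v0 \<times> 'v1 \<Rightarrow> 'v0 \<times> 'v1 \<Rightarrow> 'v0 \<times> 'v1).
    (pullback_bracket d (action_part l), bracket_part l, d, ext_action s1 s0 (action_part l)))"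
  \<comment> \<open>The inverse assembles \<open>l\<close> from \<open>brh\<close> and
    \<open>\<alpha>\<close>. The bracket \<open>brg\<close> is recovered from the result, because it
    equals \<open>\<alpha> (wedge s0 (\<mu> f) (\<mu> g)) h\<close>.\<close>
  define \<Psi> where "\<Psi> = (\<lambda>(brg :: 'v1 \<Rightarrow> 'v1 \<Rightarrow> 'v1 \<Rightarrow> 'v1, brh,
      \<mu> :: 'v1 \<Rightarrow> 'v0, \<alpha> :: ('v0 \<times> 'v0 \<Rightarrow>\<^sub>0 'k) set \<Rightarrow> 'v1 \<Rightarrow> 'v1).
    (\<mu>, total_bracket brh (\<lambda>x y. \<alpha> (wedge s0 x y))))"
  note strict = crossed_action_of_strict[OF assms]
  have \<Phi>: "crossed_module s1 s0 (pullback_bracket d (action_part l)) (bracket_part l) d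
      (ext_action s1 s0 (action_part l))"
    and \<Psi>\<Phi>: "\<Psi> (\<Phi> (d, l)) = (d, l)"
    and wedge: "ext_action s1 s0 (action_part l) (wedge s0 x y) = action_part l x y"
    if l: "strict_three_lie_two_algebra s1 s0 d l" for d l x y
  proof -
    interpret crossed_action s1 s0 d "bracket_part l" "action_part l"
      using l by (rule strict)
    show "crossed_module s1 s0 (pullback_bracket d (action_part l)) (bracket_part l) d
        (ext_action s1 s0 (action_part l))"
      by (rule crossed_module_ext_action)
    show "ext_action s1 s0 (action_part l) (wedge s0 x y) = action_part l x y"
      by (rule ext_action_wedge)
    show "\<Psi> (\<Phi> (d, l)) = (d, l)"
      using strict(2)[OF l] by (simp add: \<Phi>_def \<Psi>_def ext_action_wedge)
  qed
  have \<Psi>: "strict_three_lie_two_algebra s1 s0 \<mu> (total_bracket brh (\<lambda>x y. \<alpha> (wedge s0 x y)))"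
    and \<Phi>\<Psi>: "\<Phi> (\<Psi> (brg, brh, \<mu>, \<alpha>)) = (brg, brh, \<mu>, \<alpha>)"
    if cm: "crossed_module s1 s0 brg brh \<mu> \<alpha>" for brg brh \<mu> \<alpha>
  proof -
    note crossed = crossed_action_of_crossed_module[OF cm]
    interpret crossed_action s1 s0 \<mu> brh "\<lambda>x y. \<alpha> (wedge s0 x y)"
      by (rule crossed)
    show "strict_three_lie_two_algebra s1 s0 \<mu> (total_bracket brh (\<lambda>x y. \<alpha> (wedge s0 x y)))"
      by (rule strict_total_bracket)
    show "\<Phi> (\<Psi> (brg, brh, \<mu>, \<alpha>)) = (brg, brh, \<mu>, \<alpha>)"
      by (simp add: \<Phi>_def \<Psi>_def bracket_part_total_bracket action_part_total_bracket crossed(2,3))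
  qed
  have "bij_betw \<Phi> {(d, l). strict_three_lie_two_algebra s1 s0 d l}
      {(brg, brh, \<mu>, \<alpha>). crossed_module s1 s0 brg brh \<mu> \<alpha>}"
    by (rule bij_betw_byWitness[where f' = \<Psi>])
      (auto simp: \<Psi>\<Phi> \<Phi>\<Psi>, auto simp: \<Phi>_def \<Psi>_def intro: \<Phi> \<Psi>)
  then show ?thesis
    by (intro exI[of _ \<Phi>] conjI allI impI)
      (auto simp: \<Phi>_def wedge strict(3,4) pullback_bracket_def)
qed

end
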